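(* Let $\mathbf{A}\in\mathbb{R}^{m\times n}$, $\mathbf{b}\in\mathbb{R}^m$, $\mathbf{c},\mathbf{d}\in\mathbb{R}^n$, $\alpha,\beta\in\mathbb{R}$ be such that $X=\{\mathbf{x}\in\mathbb{R}^n \mid \mathbf{A}\mathbf{x}\le\mathbf{b},\ \mathbf{x}\ge\mathbf{0}_n\}$ is non-empty and bounded and $\mathbf{d}^T\mathbf{x}+\beta>0$ for all $\mathbf{x}\in X$. Let $F_P^*$ be the set of optimal solutions $(\bar{\mathbf{x}},t,\bar{\mathbf{u}})\in\mathbb{R}^n\times\mathbb{R}\times\mathbb{R}^m$ of $$\max\ \mathbf{c}^T\bar{\mathbf{x}}+\alpha t\quad\text{s.t. } \mathbf{A}\bar{\mathbf{x}}+\bar{\mathbf{u}}=\mathbf{b}t,\ \mathbf{d}^T\bar{\mathbf{x}}+\beta t=1,\ \bar{\mathbf{x}}\ge\mathbf{0}_n,\ t\ge0,\ \bar{\mathbf{u}}\ge\mathbf{0}_m,$$ and let $F_D^*$ be the set of optimal solutions $(\mathbf{y},z,\mathbf{v})\in\mathbb{R}^m\times\mathbb{R}\times\mathbb{R}^n$ of $$\min\ z\quad\text{s.t. } \mathbf{A}^T\mathbf{y}+\mathbf{d}z-\mathbf{v}=\mathbf{c},\ -\mathbf{b}^T\mathbf{y}+\beta z=\alpha,\ \mathbf{y}\ge\mathbf{0}_m,\ \mathbf{v}\ge\mathbf{0}_n.$$ If $(\bar{\mathbf{x}}^*,t^*,\bar{\mathbf{u}}^* )\in ri(F_P^* )$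 and $(\mathbf{y}^*,z^*,\mathbf{v}^* )\in ri(F_D^* )$, then $\left(\frac{1}{t^*}(\bar{\mathbf{x}}^*,\bar{\mathbf{u}}^* ),(\mathbf{y}^*,z^*,\mathbf{v}^* )\right)$ is a strict complementary solution for the linear fractional program $\max\{(\mathbf{c}^T\mathbf{x}+\alpha)/(\mathbf{d}^T\mathbf{x}+\beta)\mid \mathbf{x}\in X\}$ and its dual $\min\{z \mid \mathbf{A}^T\mathbf{y}+\mathbf{d}z\ge\mathbf{c},\ -\mathbf{b}^T\mathbf{y}+\beta z=\alpha,\ \mathbf{y}\ge\mathbf{0}_m\}$.
   Context: Vector inequalities are componentwise; $\mathbf{0}_k$ is the zero vector of $\mathbb{R}^k$; $ri(\cdot)$ denotes the relative interior of a convex set. A feasible primal-dual solution is a pair $\left((\mathbf{x}^*,\mathbf{u}^* ),(\mathbf{y}^*,z^*,\mathbf{v}^* )\right)$ where $\mathbf{x}^*$ is feasible for the linear fractional program, $(\mathbf{y}^*,z^* )$ is feasible for the dual problem ($z$ is free in sign), and $\mathbf{u}^*=\mathbf{b}-\mathbf{A}\mathbf{x}^*$, $\mathbf{v}^*=\mathbf{A}^T\mathbf{y}^*+\mathbf{d}z^*-\mathbf{c}$ are the slack vectors. It is called a strict complementary solution if $$\mathbf{x}^{*T}\mathbf{v}^*=0,\quad \mathbf{y}^{*T}\mathbf{u}^*=0,\quad \mathbf{x}^*+\mathbf{v}^*>\mathbf{0}_n,\quad \mathbf{y}^*+\mathbf{u}^*>\mathbf{0}_m,$$ where the strict inequalities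 hold in every component. *)

theory Defs
  imports "HOL-Analysis.Analysis"
begin

text \<open>
  Linear fractional program: maximize \<open>(c \<bullet> x + \<alpha>) / (d \<bullet> x + \<beta>)\<close> over \<open>lfp_feasible A b\<close>.
  Its dual: minimize \<open>z\<close> over \<open>lfd_feasible A b c d \<alpha> \<beta>\<close>.
  The library order \<open>\<le>\<close> on vectors is componentwise, but \<open>x < y\<close> there only means
  \<open>x \<le> y \<and> x \<noteq> y\<close>; strict vector inequalities are therefore written out by components.
\<close>

definition lfp_feasible :: "real^'n^'m \<Rightarrow> real^'m \<Rightarrow> (real^'n) set" where
  "lfp_feasible A b = {x. A *v x \<le> b \<and> 0 \<le> x}"

definition lfd_feasible ::
  "real^'n^'m \<Rightarrow> real^'m \<Rightarrow> real^'n \<Rightarrow> real^'n \<Rightarrow> real \<Rightarrow> real \<Rightarrow> ((real^'m) \<times> real) set" where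
  "lfd_feasible A b c d \<alpha> \<beta> =
     {(y, z). c \<le> transpose A *v y + z *\<^sub>R d \<and> - (b \<bullet> y) + \<beta> * z = \<alpha> \<and> 0 \<le> y}"

definition lin_primal_feasible ::
  "real^'n^'m \<Rightarrow> real^'m \<Rightarrow> real^'n \<Rightarrow> real \<Rightarrow> ((real^'n) \<times> real \<times> (real^'m)) set" where
  "lin_primal_feasible A b d \<beta> =
     {(x, t, u). A *v x + u = t *\<^sub>R b \<and> d \<bullet> x + \<beta> * t = 1 \<and> 0 \<le> x \<and> 0 \<le> t \<and> 0 \<le> u}"

definition lin_primal_optimal ::
  "real^'n^'m \<Rightarrow> real^'m \<Rightarrow> real^'n \<Rightarrow> real^'n \<Rightarrow> real \<Rightarrow> real
    \<Rightarrow> ((real^'n) \<times> real \<times> (real^'m)) set" where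
  "lin_primal_optimal A b c d \<alpha> \<beta> =
     {w. is_arg_max (\<lambda>(x, t, u). c \<bullet> x + \<alpha> * t) (\<lambda>w. w \<in> lin_primal_feasible A b d \<beta>) w}"

definition lin_dual_feasible ::
  "real^'n^'m \<Rightarrow> real^'m \<Rightarrow> real^'n \<Rightarrow> real^'n \<Rightarrow> real \<Rightarrow> real
    \<Rightarrow> ((real^'m) \<times> real \<times> (real^'n)) set" where
  "lin_dual_feasible A b c d \<alpha> \<beta> =
     {(y, z, v). transpose A *v y + z *\<^sub>R d - v = c \<and> - (b \<bullet> y) + \<beta> * z = \<alpha> \<and> 0 \<le> y \<and> 0 \<le> v}"

definition lin_dual_optimal ::
  "real^'n^'m \<Rightarrow> real^'m \<Rightarrow> real^'n \<Rightarrow> real^'n \<Rightarrow> real \<Rightarrow> real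
    \<Rightarrow> ((real^'m) \<times> real \<times> (real^'n)) set" where
  "lin_dual_optimal A b c d \<alpha> \<beta> =
     {w. is_arg_min (\<lambda>(y, z, v). z) (\<lambda>w. w \<in> lin_dual_feasible A b c d \<alpha> \<beta>) w}"

definition feasible_primal_dual ::
  "real^'n^'m \<Rightarrow> real^'m \<Rightarrow> real^'n \<Rightarrow> real^'n \<Rightarrow> real \<Rightarrow> real
    \<Rightarrow> ((real^'n) \<times> (real^'m)) \<times> ((real^'m) \<times> real \<times> (real^'n)) \<Rightarrow> bool" where
  "feasible_primal_dual A b c d \<alpha> \<beta> = (\<lambda>((x, u), (y, z, v)).
     x \<in> lfp_feasible A b \<and> (y, z) \<in> lfd_feasible A b c d \<alpha> \<beta> \<and>
     u = b - A *v x \<and> v = transpose A *v y + z *\<^sub>R d - c)"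

definition strict_complementary_solution ::
  "real^'n^'m \<Rightarrow> real^'m \<Rightarrow> real^'n \<Rightarrow> real^'n \<Rightarrow> real \<Rightarrow> real
    \<Rightarrow> ((real^'n) \<times> (real^'m)) \<times> ((real^'m) \<times> real \<times> (real^'n)) \<Rightarrow> bool" where
  "strict_complementary_solution A b c d \<alpha> \<beta> = (\<lambda>((x, u), (y, z, v)).
     feasible_primal_dual A b c d \<alpha> \<beta> ((x, u), (y, z, v)) \<and>
     x \<bullet> v = 0 \<and> y \<bullet> u = 0 \<and>
     (\<forall>j. (x + v) $ j > 0) \<and> (\<forall>i. (y + u) $ i > 0))"

end

theory Submission
  imports Defs
begin

text \<open>
  The heart is a theorem of the alternative of Tucker type: for a subspace \<open>M\<close> and \<open>e \<ge> 0\<close>, either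
  \<open>M\<close> contains a vector above \<open>e\<close>, or some nonnegative vector orthogonal to \<open>M\<close> has positive inner
  product with \<open>e\<close>. Applied to the homogenized primal-dual pair it shows that for every
  complementary pair of coordinates one of the two is positive at some optimal solution.
  A linear functional that is nonnegative on a set and positive somewhere on it is positive on the
  relative interior, so the coordinate is positive at the given solution as well.
\<close>

section \<open>A theorem of the alternative\<close>

text \<open>If no vector of \<open>M\<close> lies above \<open>e\<close>, then \<open>e\<close> is
  outside the cone of all vectors lying below some element of \<open>M\<close>. A finitely generated
  cone inside it is closed, so a hyperplane strictly separates \<open>e\<close> from it; the negated
  normal serves as \<open>h\<close>.\<close>

lemma subspace_alternative:
  fixes M :: "'a::ordered_euclidean_space set"
  assumes M: "subspace M"
  obtains w where "w \<in> M" "e \<le> w"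
  | h where "\<And>w. w \<in> M \<Longrightarrow> h \<bullet> w = 0" "0 \<le> h" "0 < h \<bullet> e"
proof (cases "\<exists>w\<in>M. e \<le> w")
  case True
  then show ?thesis using that(1) by blast
next
  case False
  obtain B where B: "finite B" "span B = M"
    by (metis M basis_exists finiteI_independent span_subspace)
  \<comment> \<open>\<open>B\<close> and its negatives generate \<open>M\<close> as a cone, and the
    negated basis vectors generate the nonpositive orthant. Finiteness of \<open>T\<close> is what
    makes the hull closed.\<close>
  define T where "T = B \<union> uminus ` B \<union> uminus ` Basis"
  have BM: "B \<subseteq> M" using B(2) span_superset by blast
  have "convex_cone {w. \<exists>m\<in>M. w \<le> m}"
    unfolding convex_cone_iff
  proof (intro conjI ballI allI impI)
    show "0 \<in> {w. \<exists>m\<in>M. w \<le> m}" using subspace_0[OF M] by auto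
  next
    fix w w' assume "w \<in> {w. \<exists>m\<in>M. w \<le> m}" "w' \<in> {w. \<exists>m\<in>M. w \<le> m}"
    then obtain m m' where "m \<in> M" "m' \<in> M" "w \<le> m" "w' \<le> m'" by auto
    then have "m + m' \<in> M" "w + w' \<le> m + m'" using subspace_add[OF M] by (auto intro: add_mono)
    then show "w + w' \<in> {w. \<exists>m\<in>M. w \<le> m}" by blast
  next
    fix w and r :: real assume "w \<in> {w. \<exists>m\<in>M. w \<le> m}" "0 \<le> r"
    then show "r *\<^sub>R w \<in> {w. \<exists>m\<in>M. w \<le> m}"
      using subspace_mul[OF M] by (auto intro: scaleR_left_mono)
  qed
  moreover have "T \<subseteq> {w. \<exists>m\<in>M. w \<le> m}"
  proof
    fix w assume "w \<in> T"
    then consider "w \<in> M" | i where "i \<in> Basis" "w = - i"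
      using BM subspace_neg[OF M] by (auto simp: T_def)
    then show "w \<in> {w. \<exists>m\<in>M. w \<le> m}"
    proof cases
      case 1
      then show ?thesis by auto
    next
      case 2
      then have "w \<le> 0" by (simp add: eucl_le[of w])
      then show ?thesis using subspace_0[OF M] by blast
    qed
  qed
  ultimately have "convex_cone hull T \<subseteq> {w. \<exists>m\<in>M. w \<le> m}"
    by (intro hull_minimal)
  then have "e \<notin> convex_cone hull T" using False by blast
  moreover have "finite T" using B by (simp add: T_def)
  ultimately obtain a k where ak: "a \<bullet> e < k" "\<And>w. w \<in> convex_cone hull T \<Longrightarrow> k < a \<bullet> w"
    using separating_hyperplane_closed_point[of "convex_cone hull T" e]
    by (auto simp: closed_convex_cone_hull convex_convex_cone_hull)
  have k: "k < 0" using ak(2)[OF convex_cone_hull_contains_0] by simp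
  \<comment> \<open>A generator with negative value could be stretched, by the positive factor
    \<open>k / (a \<bullet> w)\<close>, until its value is exactly \<open>k\<close>, which the
    strict separation excludes.\<close>
  have pos: "0 \<le> a \<bullet> w" if "w \<in> T" for w
  proof (rule ccontr)
    assume neg: "\<not> 0 \<le> a \<bullet> w"
    have "(k / (a \<bullet> w)) *\<^sub>R w \<in> convex_cone hull T"
      using that neg k by (intro convex_cone_hull_mul hull_inc) (auto simp: divide_nonpos_neg)
    from ak(2)[OF this] show False using neg by simp
  qed
  have "a \<bullet> w = 0" if "w \<in> B" for w
    using pos[of w] pos[of "- w"] that by (auto simp: T_def)
  then have "a \<bullet> w = 0" if "w \<in> M" for w
    using orthogonal_to_span[of w B a] that B by (simp add: orthogonal_def)
  moreover have "0 \<le> - a"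
    using pos[of "- i" for i] by (auto simp: eucl_le[of a 0] T_def)
  ultimately show ?thesis using that(2)[of "- a"] ak(1) k by auto
qed

section \<open>Positivity on the relative interior\<close>

text \<open>From a relative interior point \<open>p\<close> one can move a little further along the
  line from \<open>q\<close> through \<open>p\<close> without leaving \<open>F\<close>. If the
  functional vanished at \<open>p\<close>, it would be negative there.\<close>

lemma rel_interior_inner_pos:
  fixes F :: "'a::euclidean_space set"
  assumes p: "p \<in> rel_interior F" and q: "q \<in> F" "0 < a \<bullet> q"
    and nonneg: "\<And>w. w \<in> F \<Longrightarrow> 0 \<le> a \<bullet> w"
  shows "0 < a \<bullet> p"
proof -
  obtain r where r: "0 < r" "cball p r \<inter> affine hull F \<subseteq> F" and pF: "p \<in> F"
    using p by (auto simp: mem_rel_interior_cball)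
  \<comment> \<open>The step has length at most \<open>r\<close>; the added 1 keeps the quotient
    defined when \<open>p = q\<close>.\<close>
  define s where "s = r / (norm (p - q) + 1)"
  have n: "0 < norm (p - q) + 1" by (smt (verit) norm_ge_zero)
  then have s: "0 < s" using r by (simp add: s_def)
  have "s * norm (p - q) \<le> r"
    using n r by (simp add: s_def field_simps)
  then have "p + s *\<^sub>R (p - q) \<in> cball p r"
    using s by (simp add: dist_norm)
  moreover have "p + s *\<^sub>R (p - q) = (1 + s) *\<^sub>R p + (- s) *\<^sub>R q"
    by (simp add: algebra_simps)
  then have "p + s *\<^sub>R (p - q) \<in> affine hull F"
    using mem_affine[OF affine_affine_hull, of p F q "1 + s" "- s"] pF q by (simp add: hull_inc)
  ultimately have "0 \<le> a \<bullet> (p + s *\<^sub>R (p - q))" using r nonneg by blast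
  then have "s * (a \<bullet> q) \<le> (1 + s) * (a \<bullet> p)" by (simp add: algebra_simps)
  then have "0 < (1 + s) * (a \<bullet> p)" using s q by (smt (verit) mult_pos_pos)
  then show ?thesis using s by (simp add: zero_less_mult_iff)
qed

section \<open>Duality for the linearized program\<close>

lemma inner_nonneg_vec:
  fixes x y :: "real^'n"
  assumes "0 \<le> x" "0 \<le> y"
  shows "0 \<le> x \<bullet> y"
  using assms by (auto simp: inner_vec_def less_eq_vec_def intro!: sum_nonneg)

text \<open>The gap is the sum of the products of paired variables and slacks. With
  \<open>l = 1\<close> and \<open>\<tau> = 1\<close> this gives weak duality and complementary
  slackness; a general \<open>l\<close> covers the homogenized dual.\<close>

lemma duality_gap:
  fixes A :: "real^'n^'m"
  assumes "A *v x + u = t *\<^sub>R b" "d \<bullet> x + \<beta> * t = \<tau>"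
  shows "z * \<tau> - l * (c \<bullet> x + \<alpha> * t)
    = y \<bullet> u + (transpose A *v y + z *\<^sub>R d - l *\<^sub>R c) \<bullet> x + (- (b \<bullet> y) + \<beta> * z - l * \<alpha>) * t"
proof -
  have "y \<bullet> u = y \<bullet> (t *\<^sub>R b - A *v x)"
    by (simp add: assms(1)[symmetric])
  then have "y \<bullet> u = t * (b \<bullet> y) - y \<bullet> (A *v x)"
    by (simp add: inner_diff_right inner_commute[of y b])
  then show ?thesis
    by (simp add: assms(2)[symmetric] inner_diff_left inner_diff_right inner_add_left
        dot_lmul_matrix inner_commute[of y b] algebra_simps)
qed

text \<open>If \<open>t = 0\<close>, the normalization forces \<open>x\<close> to be nonzero, and
  \<open>x\<close> is then a recession direction of the bounded set
  \<open>lfp_feasible A b\<close>.\<close>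

lemma lin_primal_feasible_t_pos:
  fixes A :: "real^'n^'m"
  assumes ne: "lfp_feasible A b \<noteq> {}" and bd: "bounded (lfp_feasible A b)"
    and P: "(x, t, u) \<in> lin_primal_feasible A b d \<beta>"
  shows "0 < t"
proof (rule ccontr)
  assume "\<not> 0 < t"
  then have t: "t = 0" using P by (auto simp: lin_primal_feasible_def)
  have x: "x \<noteq> 0" "0 \<le> x" "0 \<le> u" "A *v x = - u"
    using P by (auto simp: t lin_primal_feasible_def eq_neg_iff_add_eq_0)
  obtain w where w: "A *v w \<le> b" "0 \<le> w" using ne by (auto simp: lfp_feasible_def)
  obtain K where K: "\<And>q. q \<in> lfp_feasible A b \<Longrightarrow> norm q \<le> K"
    using bd by (auto simp: bounded_iff)
  have ray: "w + r *\<^sub>R x \<in> lfp_feasible A b" if "0 \<le> r" for r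
  proof -
    have "A *v (w + r *\<^sub>R x) = A *v w - r *\<^sub>R u"
      by (simp add: matrix_vector_right_distrib matrix_vector_mult_scaleR x(4))
    also have "\<dots> \<le> b" using w(1) scaleR_nonneg_nonneg[OF that x(3)] by (smt (verit) diff_left_mono diff_zero order_trans)
    finally show ?thesis
      using w(2) scaleR_nonneg_nonneg[OF that x(2)] by (simp add: lfp_feasible_def)
  qed
  \<comment> \<open>Long enough that, by the triangle inequality, \<open>w + r *\<^sub>R x\<close>
    has norm above the bound \<open>K\<close>.\<close>
  define r where "r = (K + norm w + 1) / norm x"
  have K0: "0 \<le> K" using K[OF ray[of 0]] by (smt (verit) norm_ge_zero order_refl)
  then have r0: "0 \<le> r" by (simp add: r_def)
  have "norm (r *\<^sub>R x) = K + norm w + 1" using x(1) K0 by (simp add: r_def)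
  moreover have "norm (r *\<^sub>R x) \<le> norm (w + r *\<^sub>R x) + norm w"
    by (metis add_diff_cancel_left' norm_triangle_ineq4 )
  ultimately show False using K[OF ray[OF r0]] by simp
qed

text \<open>
  In the proof \<open>p\<close> is the optimal value, \<open>l\<close> homogenizes the dual and \<open>\<tau>\<close> the primal program.
\<close>

lemma strict_alternative:
  fixes A :: "real^'n^'m"
  assumes opt: "(x0, t0, u0) \<in> lin_primal_optimal A b c d \<alpha> \<beta>" and t0: "0 < t0"
    and e: "0 \<le> e1" "0 \<le> e2"
  obtains x t u where "(x, t, u) \<in> lin_primal_optimal A b c d \<alpha> \<beta>" "0 < x \<bullet> e1 + u \<bullet> e2"
  | y v r where "(y, c \<bullet> x0 + \<alpha> * t0, v) \<in> lin_dual_optimal A b c d \<alpha> \<beta>"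
      "0 < r" "r *\<^sub>R e1 \<le> v" "r *\<^sub>R e2 \<le> y"
proof -
  define p where "p = c \<bullet> x0 + \<alpha> * t0"
  have P0: "A *v x0 + u0 = t0 *\<^sub>R b" "d \<bullet> x0 + \<beta> * t0 = 1" "0 \<le> x0" "0 \<le> u0"
    and best: "\<And>x t u. (x, t, u) \<in> lin_primal_feasible A b d \<beta> \<Longrightarrow> c \<bullet> x + \<alpha> * t \<le> p"
    using opt by (auto simp: lin_primal_optimal_def is_arg_max_linorder lin_primal_feasible_def p_def)
  \<comment> \<open>The components are the left-hand sides of the homogenized dual inequalities, so
    an orthogonal vector lists their multipliers \<open>x\<close>, \<open>t\<close>,
    \<open>u\<close>, \<open>q\<close>, \<open>\<tau>\<close>. Nonnegativity of the last component
    says that the dual value is no worse than \<open>p\<close>.\<close>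
  define g where "g = (\<lambda>(y, z, l). (transpose A *v y + z *\<^sub>R d - l *\<^sub>R c,
      - (b \<bullet> y) + \<beta> * z - l * \<alpha>, y, l, p * l - z))"
  have "linear g"
    by (rule linearI)
      (auto simp: g_def matrix_vector_right_distrib matrix_vector_mult_scaleR algebra_simps
        inner_add_right scaleR_vector_matrix_assoc)
  then have sub: "subspace (range g)" by (simp add: linear_subspace_image)
  have gI: "g (y, z, l) \<in> range g" for y z l by simp
  \<comment> \<open>The bounds \<open>f1\<close>, \<open>f2\<close>, \<open>k\<close> are the
    demands on the dual side; on the primal side \<open>q\<close> is the excess over the optimal
    value, which optimality will force to be 0.\<close>
  have alt: "(\<exists>y z l. f1 \<le> transpose A *v y + z *\<^sub>R d - l *\<^sub>R c \<and>
        0 \<le> - (b \<bullet> y) + \<beta> * z - l * \<alpha> \<and> f2 \<le> y \<and> k \<le> l \<and> z \<le> p * l)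
    \<or> (\<exists>x t u q. (x, t, u) \<in> lin_primal_feasible A b d \<beta> \<and> 0 \<le> q \<and> c \<bullet> x + \<alpha> * t = p + q
        \<and> (0 < x \<bullet> f1 + u \<bullet> f2 \<or> 0 < q))"
    if f: "0 \<le> f1" "0 \<le> f2" "0 \<le> k" for f1 f2 k
  proof (rule subspace_alternative[OF sub, of "(f1, 0, f2, k, 0)"])
    fix w assume w: "w \<in> range g" "(f1, 0, f2, k, 0) \<le> w"
    then obtain y z l where "w = g (y, z, l)" by (metis rangeE prod_cases3)
    with w(2) show ?thesis
      by (intro disjI1 exI[of _ y] exI[of _ z] exI[of _ l]) (simp add: g_def)
  next
    fix h assume perp: "\<And>w. w \<in> range g \<Longrightarrow> h \<bullet> w = 0" and h: "0 \<le> h" "0 < h \<bullet> (f1, 0, f2, k, 0)"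
    obtain x t u q \<tau> where hq: "h = (x, t, u, q, \<tau>)" by (metis prod_cases5)
    have nn: "0 \<le> x" "0 \<le> t" "0 \<le> u" "0 \<le> q" "0 \<le> \<tau>"
      using h(1) by (auto simp: hq zero_prod_def)
    \<comment> \<open>Testing orthogonality on each of the three arguments of \<open>g\<close>
      separately recovers the homogenized primal constraints and the objective value.\<close>
    have "(A *v x + u - t *\<^sub>R b) \<bullet> y = 0" for y
      using perp[OF gI[of y 0 0]]
      by (simp add: hq g_def inner_diff_left inner_add_left inner_commute[of x]
          dot_lmul_matrix inner_commute[of y])
    then have Ax: "A *v x + u = t *\<^sub>R b"
      by (metis eq_iff_diff_eq_0 inner_eq_zero_iff)
    have dx: "d \<bullet> x + \<beta> * t = \<tau>"
      using perp[OF gI[of 0 1 0]] by (simp add: hq g_def inner_commute algebra_simps)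
    have cx: "c \<bullet> x + \<alpha> * t = p * \<tau> + q"
      using perp[OF gI[of 0 0 1]] by (simp add: hq g_def inner_commute algebra_simps)
    \<comment> \<open>Since \<open>\<tau>\<close> may be 0, the multipliers alone cannot be
      normalized. Adding the optimal solution makes the normalization value
      \<open>1 + \<tau>\<close>, which is positive.\<close>
    define s where "s = 1 / (1 + \<tau>)"
    have s: "0 < s" "s * (1 + \<tau>) = 1" using nn by (auto simp: s_def)
    have feas: "(s *\<^sub>R (x0 + x), s * (t0 + t), s *\<^sub>R (u0 + u)) \<in> lin_primal_feasible A b d \<beta>"
    proof -
      have "A *v (s *\<^sub>R (x0 + x)) + s *\<^sub>R (u0 + u) = s *\<^sub>R ((A *v x0 + u0) + (A *v x + u))"
        by (simp add: matrix_vector_right_distrib matrix_vector_mult_scaleR algebra_simps)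
      also have "\<dots> = (s * (t0 + t)) *\<^sub>R b"
        unfolding Ax P0(1) by (simp add: algebra_simps)
      moreover have "d \<bullet> (s *\<^sub>R (x0 + x)) + \<beta> * (s * (t0 + t))
          = s * ((d \<bullet> x0 + \<beta> * t0) + (d \<bullet> x + \<beta> * t))"
        by (simp add: inner_add_right algebra_simps)
      then have "d \<bullet> (s *\<^sub>R (x0 + x)) + \<beta> * (s * (t0 + t)) = 1"
        using s(2) by (simp add: P0(2) dx)
      ultimately show ?thesis
        using s(1) nn P0 t0 by (simp add: lin_primal_feasible_def scaleR_nonneg_nonneg)
    qed
    have "c \<bullet> (s *\<^sub>R (x0 + x)) + \<alpha> * (s * (t0 + t))
        = s * ((c \<bullet> x0 + \<alpha> * t0) + (c \<bullet> x + \<alpha> * t))"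
      by (simp add: inner_add_right algebra_simps)
    also have "\<dots> = p * (s * (1 + \<tau>)) + s * q"
      unfolding cx p_def[symmetric] by (simp add: algebra_simps)
    finally have val: "c \<bullet> (s *\<^sub>R (x0 + x)) + \<alpha> * (s * (t0 + t)) = p + s * q"
      by (simp add: s(2))
    have "0 < x \<bullet> f1 + u \<bullet> f2 \<or> 0 < q"
      using h(2) nn f by (auto simp: hq)
    moreover have "(s *\<^sub>R (x0 + x)) \<bullet> f1 + (s *\<^sub>R (u0 + u)) \<bullet> f2
        = s * (x0 \<bullet> f1 + u0 \<bullet> f2) + s * (x \<bullet> f1 + u \<bullet> f2)"
      by (simp add: inner_add_left algebra_simps)
    moreover have "0 \<le> s * (x0 \<bullet> f1 + u0 \<bullet> f2)"
      using s(1) P0 f by (intro mult_nonneg_nonneg add_nonneg_nonneg inner_nonneg_vec) auto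
    ultimately have "0 < (s *\<^sub>R (x0 + x)) \<bullet> f1 + (s *\<^sub>R (u0 + u)) \<bullet> f2 \<or> 0 < s * q"
      using s(1) by (smt (verit) mult_pos_pos)
    moreover have "0 \<le> s * q" using s nn by simp
    ultimately show ?thesis using feas val by blast
  qed
  have q0: "q = 0" if "(x, t, u) \<in> lin_primal_feasible A b d \<beta>" "0 \<le> q" "c \<bullet> x + \<alpha> * t = p + q"
    for x t u q using best[OF that(1)] that by simp
  have optP: "(x, t, u) \<in> lin_primal_optimal A b c d \<alpha> \<beta>"
    if "(x, t, u) \<in> lin_primal_feasible A b d \<beta>" "c \<bullet> x + \<alpha> * t = p" for x t u
    using that best by (auto simp: lin_primal_optimal_def is_arg_max_linorder)
  \<comment> \<open>Demanding only \<open>1 \<le> l\<close> leaves a positive excess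
    \<open>q\<close> as the sole primal alternative, which is impossible. The result is a
    homogenized dual solution that can be divided by its \<open>l\<close>.\<close>
  have "\<exists>y z l. 0 \<le> transpose A *v y + z *\<^sub>R d - l *\<^sub>R c \<and>
      0 \<le> - (b \<bullet> y) + \<beta> * z - l * \<alpha> \<and> 0 \<le> y \<and> 1 \<le> l \<and> z \<le> p * l"
    using alt[of 0 0 1] q0 by (metis add_0 inner_zero_right less_irrefl order_refl zero_le_one)
  then obtain y1 z1 l1 where 1:
    "0 \<le> transpose A *v y1 + z1 *\<^sub>R d - l1 *\<^sub>R c"
    "0 \<le> - (b \<bullet> y1) + \<beta> * z1 - l1 * \<alpha>" "0 \<le> y1" "1 \<le> l1" "z1 \<le> p * l1"
    by blast
  consider
    (P) x t u where "(x, t, u) \<in> lin_primal_optimal A b c d \<alpha> \<beta>" "0 < x \<bullet> e1 + u \<bullet> e2"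
  | (D) y2 z2 l2 where "e1 \<le> transpose A *v y2 + z2 *\<^sub>R d - l2 *\<^sub>R c"
    "0 \<le> - (b \<bullet> y2) + \<beta> * z2 - l2 * \<alpha>" "e2 \<le> y2" "0 \<le> l2" "z2 \<le> p * l2"
    using alt[OF e order_refl] q0 optP by (metis add_0_right less_irrefl)
  then show ?thesis
  proof cases
    case P
    then show ?thesis using that(1) by blast
  next
    case D
    \<comment> \<open>The first summand makes \<open>l\<close> positive, the second supplies the
      bounds \<open>e1\<close> and \<open>e2\<close>; the homogenized constraints survive
      addition.\<close>
    define y z l where "y = y1 + y2" and "z = z1 + z2" and "l = l1 + l2"
    define v where "v = transpose A *v y + z *\<^sub>R d - l *\<^sub>R c"
    define s where "s = - (b \<bullet> y) + \<beta> * z - l * \<alpha>"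
    have "v = (transpose A *v y1 + z1 *\<^sub>R d - l1 *\<^sub>R c) + (transpose A *v y2 + z2 *\<^sub>R d - l2 *\<^sub>R c)"
      by (simp add: v_def y_def z_def l_def matrix_vector_right_distrib algebra_simps)
    then have v: "e1 \<le> v" using add_mono[OF 1(1) D(1)] by simp
    have y: "e2 \<le> y" using add_mono[OF 1(3) D(3)] by (simp add: y_def)
    have s: "0 \<le> s" using 1(2) D(2) by (simp add: s_def y_def z_def l_def inner_add_right algebra_simps)
    have l: "0 < l" using 1 D by (simp add: l_def)
    have z: "z \<le> l * p" using 1 D by (simp add: z_def l_def algebra_simps)
    have vy0: "0 \<le> v" "0 \<le> y" using v y e by (auto intro: order_trans)
    \<comment> \<open>Since \<open>t0 > 0\<close>, complementary slackness turns the inequality paired with \<open>t\<close> into the equation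
      that the dual program demands.\<close>
    have "z - l * p = y \<bullet> u0 + v \<bullet> x0 + s * t0"
      using duality_gap[OF P0(1,2), of z l c \<alpha> y] by (simp add: p_def v_def s_def)
    moreover have "0 \<le> y \<bullet> u0" "0 \<le> v \<bullet> x0" "0 \<le> s * t0"
      using vy0 P0 s t0 by (auto intro: inner_nonneg_vec)
    ultimately have "s * t0 = 0" and zl: "z = l * p" using z by linarith+
    then have s0: "s = 0" using t0 by simp
    have feasD: "((1 / l) *\<^sub>R y, p, (1 / l) *\<^sub>R v) \<in> lin_dual_feasible A b c d \<alpha> \<beta>"
    proof -
      have "transpose A *v ((1 / l) *\<^sub>R y) + p *\<^sub>R d - (1 / l) *\<^sub>R v = c"
        using l
        by (simp add: v_def zl scaleR_vector_matrix_assoc algebra_simps)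
      moreover have "- (b \<bullet> ((1 / l) *\<^sub>R y)) + \<beta> * p = \<alpha>"
        using l s0 by (simp add: s_def zl field_simps)
      ultimately show ?thesis
        using l vy0 by (simp add: lin_dual_feasible_def scaleR_nonneg_nonneg)
    qed
    have "p \<le> z'" if "(y', z', v') \<in> lin_dual_feasible A b c d \<alpha> \<beta>" for y' z' v'
    proof -
      have v': "transpose A *v y' + z' *\<^sub>R d - c = v'" "- (b \<bullet> y') + \<beta> * z' = \<alpha>" "0 \<le> y'" "0 \<le> v'"
        using that by (auto simp: lin_dual_feasible_def)
      then show ?thesis
        using duality_gap[OF P0(1,2), of z' 1 c \<alpha> y'] inner_nonneg_vec[of y' u0]
          inner_nonneg_vec[of v' x0] P0 by (simp add: p_def)
    qed
    then have "((1 / l) *\<^sub>R y, p, (1 / l) *\<^sub>R v) \<in> lin_dual_optimal A b c d \<alpha> \<beta>"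
      using feasD by (auto simp: lin_dual_optimal_def is_arg_min_linorder)
    then show ?thesis
      using that(2)[of "(1 / l) *\<^sub>R y" "(1 / l) *\<^sub>R v" "1 / l"] l v y
      by (simp add: p_def scaleR_left_mono)
  qed
qed

section \<open>Strict complementarity at relative interior points\<close>

theorem theorem3p1:
  fixes A :: "real^'n^'m" and b :: "real^'m" and c d :: "real^'n" and \<alpha> \<beta> :: real
    and x :: "real^'n" and t :: real and u :: "real^'m"
    and y :: "real^'m" and z :: real and v :: "real^'n"
  assumes "lfp_feasible A b \<noteq> {}"
    and "bounded (lfp_feasible A b)"
    and "\<forall>x \<in> lfp_feasible A b. d \<bullet> x + \<beta> > 0"
    and "(x, t, u) \<in> rel_interior (lin_primal_optimal A b c d \<alpha> \<beta>)"
    and "(y, z, v) \<in> rel_interior (lin_dual_optimal A b c d \<alpha> \<beta>)"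
  shows "t \<noteq> 0 \<and>
    strict_complementary_solution A b c d \<alpha> \<beta> ((1 / t) *\<^sub>R (x, u), (y, z, v))"
proof -
  let ?P = "lin_primal_optimal A b c d \<alpha> \<beta>" and ?D = "lin_dual_optimal A b c d \<alpha> \<beta>"
  have xP: "(x, t, u) \<in> ?P" and yD: "(y, z, v) \<in> ?D"
    using assms(4,5) rel_interior_subset by blast+
  have P: "A *v x + u = t *\<^sub>R b" "d \<bullet> x + \<beta> * t = 1" "0 \<le> x" "0 \<le> u"
    using xP by (auto simp: lin_primal_optimal_def is_arg_max_def lin_primal_feasible_def)
  have D: "transpose A *v y + z *\<^sub>R d - v = c" "- (b \<bullet> y) + \<beta> * z = \<alpha>" "0 \<le> y" "0 \<le> v"
    using yD by (auto simp: lin_dual_optimal_def is_arg_min_def lin_dual_feasible_def)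
  have nnP: "0 \<le> x'" "0 \<le> u'" if "(x', t', u') \<in> ?P" for x' t' u'
    using that by (auto simp: lin_primal_optimal_def is_arg_max_def lin_primal_feasible_def)
  have nnD: "0 \<le> y'" "0 \<le> v'" if "(y', z', v') \<in> ?D" for y' z' v'
    using that by (auto simp: lin_dual_optimal_def is_arg_min_def lin_dual_feasible_def)
  have t: "0 < t"
    using lin_primal_feasible_t_pos[OF assms(1,2)] xP
    by (auto simp: lin_primal_optimal_def is_arg_max_def)
  \<comment> \<open>Whichever program has an optimal solution that is positive against
    \<open>e1\<close> and \<open>e2\<close>, the given solution of that program inherits this from
    the relative interior. On the dual side positivity comes from the lower bounds
    \<open>r *\<^sub>R e1\<close> and \<open>r *\<^sub>R e2\<close>.\<close>
  have strict: "0 < x \<bullet> e1 + u \<bullet> e2 \<or> 0 < v \<bullet> e1 + y \<bullet> e2"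
    if e: "0 \<le> e1" "0 \<le> e2" "0 < e1 \<bullet> e1 + e2 \<bullet> e2" for e1 e2
  proof (rule strict_alternative[OF xP t e(1,2)])
    fix x' t' u' assume *: "(x', t', u') \<in> ?P" "0 < x' \<bullet> e1 + u' \<bullet> e2"
    have "0 < (e1, 0::real, e2) \<bullet> (x, t, u)"
    proof (rule rel_interior_inner_pos[OF assms(4) *(1)])
      show "0 < (e1, 0::real, e2) \<bullet> (x', t', u')" using *(2) by (simp add: inner_commute)
      show "0 \<le> (e1, 0::real, e2) \<bullet> w" if "w \<in> ?P" for w
        using that nnP e by (cases w) (auto intro!: add_nonneg_nonneg inner_nonneg_vec)
    qed
    then show ?thesis by (simp add: inner_commute)
  next
    fix y' v' r assume *: "(y', c \<bullet> x + \<alpha> * t, v') \<in> ?D" "0 < r" "r *\<^sub>R e1 \<le> v'" "r *\<^sub>R e2 \<le> y'"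
    have "0 < (e2, 0::real, e1) \<bullet> (y, z, v)"
    proof (rule rel_interior_inner_pos[OF assms(5) *(1)])
      have "0 \<le> e1 \<bullet> (v' - r *\<^sub>R e1)" "0 \<le> e2 \<bullet> (y' - r *\<^sub>R e2)"
        using * e by (auto intro: inner_nonneg_vec)
      moreover have "0 < r * (e1 \<bullet> e1 + e2 \<bullet> e2)" using * e by simp
      ultimately show "0 < (e2, 0::real, e1) \<bullet> (y', c \<bullet> x + \<alpha> * t, v')"
        by (simp add: inner_diff_right algebra_simps)
      show "0 \<le> (e2, 0::real, e1) \<bullet> w" if "w \<in> ?D" for w
        using that nnD e by (cases w) (auto intro!: add_nonneg_nonneg inner_nonneg_vec)
    qed
    then show ?thesis by (simp add: inner_commute)
  qed
  have axis: "0 \<le> axis i (1::real)" for i :: "'k::finite"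
    by (simp add: less_eq_vec_def axis_def)
  \<comment> \<open>A unit vector in one slot and 0 in the other isolates a single complementary
    pair of coordinates.\<close>
  have sx: "0 < x $ j \<or> 0 < v $ j" for j
    using strict[of "axis j 1" 0] axis by (simp add: inner_axis)
  have su: "0 < u $ i \<or> 0 < y $ i" for i
    using strict[of 0 "axis i 1"] axis by (simp add: inner_axis)
  have le: "z1 \<le> z2" if "(y1, z1, v1) \<in> ?D" "(y2, z2, v2) \<in> ?D" for y1 z1 v1 y2 z2 v2
  proof -
    have "(\<lambda>(y, z, v). z) (y1, z1, v1) \<le> (\<lambda>(y, z, v). z) (y2, z2, v2)"
      using that unfolding lin_dual_optimal_def is_arg_min_linorder by blast
    then show ?thesis by simp
  qed
  \<comment> \<open>With both test vectors 0 the primal alternative cannot occur, so the dual one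
    yields strong duality: the primal value is attained by a dual optimum.\<close>
  have "z = c \<bullet> x + \<alpha> * t"
  proof (rule strict_alternative[OF xP t, of 0 0])
    fix y' v' assume "(y', c \<bullet> x + \<alpha> * t, v') \<in> ?D"
    from le[OF this yD] le[OF yD this] show ?thesis by simp
  qed auto
  moreover have "transpose A *v y + z *\<^sub>R d - 1 *\<^sub>R c = v" using D(1) by (simp add: algebra_simps)
  \<comment> \<open>The gap is zero and splits into two nonnegative terms, so both vanish.\<close>
  ultimately have "y \<bullet> u + v \<bullet> x = 0"
    using duality_gap[OF P(1,2), of z 1 c \<alpha> y] D(2) by simp
  moreover have "0 \<le> y \<bullet> u" "0 \<le> v \<bullet> x" using P D by (auto intro: inner_nonneg_vec)
  ultimately have compl: "y \<bullet> u = 0" "x \<bullet> v = 0" by (auto simp: inner_commute)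
  have Ax: "(1 / t) *\<^sub>R u = b - A *v ((1 / t) *\<^sub>R x)"
  proof -
    have "(1 / t) *\<^sub>R (A *v x + u) = b" using t P(1) by simp
    then show ?thesis by (simp add: matrix_vector_mult_scaleR algebra_simps)
  qed
  have u0: "0 \<le> (1 / t) *\<^sub>R u" and x0: "0 \<le> (1 / t) *\<^sub>R x"
    using t P by (auto simp: scaleR_nonneg_nonneg)
  have "c \<le> transpose A *v y + z *\<^sub>R d" "v = transpose A *v y + z *\<^sub>R d - c"
    using D(4) unfolding D(1)[symmetric] by (simp_all add: algebra_simps)
  moreover have "A *v ((1 / t) *\<^sub>R x) \<le> b" using u0 unfolding Ax by simp
  ultimately have "feasible_primal_dual A b c d \<alpha> \<beta> (((1 / t) *\<^sub>R x, (1 / t) *\<^sub>R u), (y, z, v))"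
    using x0 Ax D(2-4)
    by (simp add: feasible_primal_dual_def lfp_feasible_def lfd_feasible_def)
  moreover have "0 < ((1 / t) *\<^sub>R x + v) $ j" for j
    using sx[of j] t P(3) D(4) by (auto simp: less_eq_vec_def intro: add_pos_nonneg add_nonneg_pos)
  moreover have "0 < (y + (1 / t) *\<^sub>R u) $ i" for i
    using su[of i] t P(4) D(3) by (auto simp: less_eq_vec_def intro: add_pos_nonneg add_nonneg_pos)
  ultimately show ?thesis
    using t compl by (simp add: strict_complementary_solution_def)
qed

end
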